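(* Let $k$ and $n$ be positive integers with $k\le n$, and let $A_{k,n}$ be the number of uniquely $k$-determined $n$-permutations. Then $$2\,((k-1)!)^{\lfloor n/k\rfloor}<A_{k,n}<2\,(2(k-1))^n .$$
   Context: An $n$-permutation is a permutation of $\{1,\ldots,n\}$ written as a word $\pi=\pi_1\pi_2\ldots\pi_n$. The pattern formed by a word of $k$ distinct integers is the unique $k$-permutation order-isomorphic to it. Graph of patterns overlaps $\mathcal{P}_k$: its nodes are all $k!$ $k$-permutations, and there is an arc from $a_1\ldots a_k$ to $b_1\ldots b_k$ if and only if $a_2\ldots a_k$ and $b_1\ldots b_{k-1}$ form the same pattern. For $n\ge k$, the path in $\mathcal{P}_k$ corresponding to an $n$-permutation $\pi$ is the sequence of $n-k+1$ nodes whose $i$-th term is the pattern formed by $\pi_i\pi_{i+1}\ldots\pi_{i+k-1}$, $i=1,\ldots,n-k+1$. An $n$-permutation $\pi$ is uniquely $k$-determined if no other $n$-permutation has the same corresponding path in $\mathcal{P}_k$.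
   Formalization: The case k = 1 is excluded (there both bounds fail, e.g. A_{1,1} = 1), and the lower bound is asserted only for k ≥ 3, since A_{2,n} = 2 makes 2·(1!)^{⌊n/2⌋} < A_{2,n} false; the upper bound is kept for all k ≥ 2. *)

theory Defs
  imports "HOL-Combinatorics.Multiset_Permutations" "Graph_Theory.Graph_Theory"
begin

definition n_permutations :: "nat \<Rightarrow> nat list set" where
  "n_permutations n = permutations_of_set {1..n}"

definition order_isomorphic :: "nat list \<Rightarrow> nat list \<Rightarrow> bool" where
  "order_isomorphic u v \<longleftrightarrow> length u = length v \<and>
     (\<forall>i<length u. \<forall>j<length u. u ! i < u ! j \<longleftrightarrow> v ! i < v ! j)"

text \<open>Only meaningful for words with distinct letters; see \<open>pattern_ex1\<close> below.\<close>

definition pattern :: "nat list \<Rightarrow> nat list" where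
  "pattern w = (THE p. p \<in> n_permutations (length w) \<and> order_isomorphic p w)"

text \<open>The graph of patterns overlaps. It has loops, at the two monotone permutations.\<close>

definition overlap_graph :: "nat \<Rightarrow> nat list pair_pre_digraph" where
  "overlap_graph k =
     \<lparr> pverts = n_permutations k,
       parcs = {(a, b). a \<in> n_permutations k \<and> b \<in> n_permutations k \<and>
                        pattern (tl a) = pattern (butlast b)} \<rparr>"

text \<open>Positions are counted from 0, so there are \<open>n - k + 1\<close> windows, with
  starting positions \<open>0, \<dots>, n - k\<close>. Meaningful for \<open>k \<le> length \<pi>\<close>.\<close>

definition overlap_path :: "nat \<Rightarrow> nat list \<Rightarrow> nat list list" where
  "overlap_path k \<pi> = map (\<lambda>i. pattern (take k (drop i \<pi>))) [0..<length \<pi> - k + 1]"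

definition uniquely_determined :: "nat \<Rightarrow> nat \<Rightarrow> nat list \<Rightarrow> bool" where
  "uniquely_determined k n \<pi> \<longleftrightarrow> \<pi> \<in> n_permutations n \<and>
     \<not> (\<exists>\<sigma>\<in>n_permutations n. \<sigma> \<noteq> \<pi> \<and> overlap_path k \<sigma> = overlap_path k \<pi>)"

definition num_uniquely_determined :: "nat \<Rightarrow> nat \<Rightarrow> nat" where
  "num_uniquely_determined k n = card {\<pi>. uniquely_determined k n \<pi>}"


lemma n_permutations_iff: "p \<in> n_permutations n \<longleftrightarrow> set p = {1..n} \<and> distinct p"
  by (simp add: n_permutations_def permutations_of_set_def)

lemma length_n_permutations: "p \<in> n_permutations n \<Longrightarrow> length p = n"
  by (metis n_permutations_iff distinct_card card_atLeastAtMost diff_Suc_1)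

lemma order_isomorphic_sym: "order_isomorphic u v \<Longrightarrow> order_isomorphic v u"
  by (auto simp: order_isomorphic_def)

lemma order_isomorphic_trans:
  "order_isomorphic u v \<Longrightarrow> order_isomorphic v w \<Longrightarrow> order_isomorphic u w"
  by (auto simp: order_isomorphic_def)

lemma order_isomorphic_sub:
  assumes "order_isomorphic u v"
  shows "order_isomorphic (take k (drop i u)) (take k (drop i v))"
  using assms by (auto simp: order_isomorphic_def)

lemma rank_in_n_permutation:
  assumes "p \<in> n_permutations n" "i < n"
  shows "p ! i = Suc (card {j. j < n \<and> p ! j < p ! i})"
proof -
  have len: "length p = n" and d: "distinct p" and s: "set p = {1..n}"
    using assms length_n_permutations n_permutations_iff by blast+
  have pi: "p ! i \<in> {1..n}" using assms(2) len s nth_mem by metis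
  have inj: "inj_on ((!) p) {j. j < n \<and> p ! j < p ! i}"
    using d len by (auto simp: inj_on_def nth_eq_iff_index_eq)
  have "(!) p ` {j. j < n \<and> p ! j < p ! i} = {x \<in> set p. x < p ! i}"
    using len by (auto simp: set_conv_nth)
  also have "\<dots> = {1..<p ! i}" using s pi by auto
  finally have "p ! i - 1 = card {j. j < n \<and> p ! j < p ! i}"
    using card_image[OF inj] by simp
  moreover have "p ! i \<ge> 1" using pi by simp
  ultimately show ?thesis by linarith
qed

lemma order_isomorphic_n_permutations_eq:
  assumes "p \<in> n_permutations n" "q \<in> n_permutations n" "order_isomorphic p q"
  shows "p = q"
proof (rule nth_equalityI)
  show "length p = length q" using assms(3) by (simp add: order_isomorphic_def)
next
  fix i assume "i < length p"
  then have i: "i < n" using assms(1) length_n_permutations by blast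
  have "{j. j < n \<and> p ! j < p ! i} = {j. j < n \<and> q ! j < q ! i}"
    using assms(3) i length_n_permutations[OF assms(1)] by (auto simp: order_isomorphic_def)
  then show "p ! i = q ! i"
    using rank_in_n_permutation[OF assms(1) i] rank_in_n_permutation[OF assms(2) i] by simp
qed

lemma pattern_ex1:
  assumes "distinct w"
  shows "\<exists>!p. p \<in> n_permutations (length w) \<and> order_isomorphic p w"
proof -
  define r where "r x = card {y \<in> set w. y \<le> x}" for x
  have mono: "r x < r y" if "x < y" "y \<in> set w" for x y
  proof -
    have "y \<in> {z \<in> set w. z \<le> y} - {z \<in> set w. z \<le> x}" using that by auto
    moreover have "{z \<in> set w. z \<le> x} \<subseteq> {z \<in> set w. z \<le> y}" using that by auto
    ultimately have "{z \<in> set w. z \<le> x} \<subset> {z \<in> set w. z \<le> y}" by blast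
    then show ?thesis unfolding r_def by (intro psubset_card_mono) auto
  qed
  have iff: "r x < r y \<longleftrightarrow> x < y" if "x \<in> set w" "y \<in> set w" for x y
    using mono that by (metis less_asym less_irrefl linorder_neqE_nat)
  have inj: "inj_on r (set w)"
    using iff by (metis inj_onI less_irrefl linorder_neqE_nat)
  have "r ` set w \<subseteq> {1..length w}"
  proof
    fix z assume "z \<in> r ` set w"
    then obtain x where x: "x \<in> set w" "z = r x" by auto
    have "r x \<le> card (set w)" unfolding r_def by (intro card_mono) auto
    moreover have "r x > 0" unfolding r_def using x by (subst card_gt_0_iff) auto
    ultimately show "z \<in> {1..length w}" using x card_length[of w] by auto
  qed
  moreover have "card (r ` set w) = length w"
    using inj assms by (simp add: card_image distinct_card)
  ultimately have "r ` set w = {1..length w}" by (intro card_subset_eq) auto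
  then have "map r w \<in> n_permutations (length w)"
    using inj assms by (simp add: n_permutations_iff distinct_map)
  moreover have "order_isomorphic (map r w) w"
    using iff by (simp add: order_isomorphic_def)
  ultimately show ?thesis
    by (metis order_isomorphic_n_permutations_eq order_isomorphic_sym order_isomorphic_trans)
qed

lemma pattern_props:
  assumes "distinct w"
  shows "pattern w \<in> n_permutations (length w)" "order_isomorphic (pattern w) w"
  using theI'[OF pattern_ex1[OF assms]] unfolding pattern_def by auto

lemma pattern_eq_iff:
  assumes "distinct u" "distinct v"
  shows "pattern u = pattern v \<longleftrightarrow> order_isomorphic u v"
proof
  assume "pattern u = pattern v"
  then show "order_isomorphic u v"
    using pattern_props(2)[OF assms(1)] pattern_props(2)[OF assms(2)]
    by (metis order_isomorphic_sym order_isomorphic_trans)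
next
  assume iso: "order_isomorphic u v"
  then have "length u = length v" by (simp add: order_isomorphic_def)
  then have "pattern v \<in> n_permutations (length u)"
    using pattern_props(1)[OF assms(2)] by simp
  moreover have "order_isomorphic (pattern u) (pattern v)"
    using iso pattern_props(2)[OF assms(1)] pattern_props(2)[OF assms(2)]
    by (metis order_isomorphic_sym order_isomorphic_trans)
  ultimately show "pattern u = pattern v"
    using order_isomorphic_n_permutations_eq pattern_props(1)[OF assms(1)] by blast
qed

lemma vwalk_arcs_nth:
  "e \<in> set (vwalk_arcs p) \<Longrightarrow> \<exists>i. Suc i < length p \<and> e = (p ! i, p ! Suc i)"
proof (induction p rule: vwalk_arcs.induct)
  case (3 x y xs)
  show ?case
  proof (cases "e = (x, y)")
    case True
    then show ?thesis by (intro exI[of _ 0]) simp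
  next
    case False
    then obtain i where "Suc i < length (y # xs)" "e = ((y # xs) ! i, (y # xs) ! Suc i)"
      using 3 by auto
    then show ?thesis by (intro exI[of _ "Suc i"]) simp
  qed
qed simp_all

lemma vwalk_overlap_path:
  assumes "\<pi> \<in> n_permutations n" "1 \<le> k" "k \<le> n"
  shows "vwalk (overlap_path k \<pi>) (overlap_graph k)"
    and "length (overlap_path k \<pi>) = n - k + 1"
proof -
  have len: "length \<pi> = n" and d: "distinct \<pi>"
    using assms length_n_permutations n_permutations_iff by blast+
  define win where "win i = take k (drop i \<pi>)" for i
  have dw: "distinct (win i)" for i using d by (simp add: win_def)
  have lw: "length (win i) = k" if "i \<le> n - k" for i
    using that assms len by (simp add: win_def)
  have node: "pattern (win i) \<in> n_permutations k" if "i \<le> n - k" for i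
    using pattern_props(1)[OF dw] lw[OF that] by metis
  show len': "length (overlap_path k \<pi>) = n - k + 1"
    by (simp add: overlap_path_def len)
  have nth: "overlap_path k \<pi> ! i = pattern (win i)" if "i \<le> n - k" for i
    using that by (simp add: overlap_path_def len win_def del: upt_Suc)
  have arc: "(pattern (win i), pattern (win (Suc i))) \<in> parcs (overlap_graph k)"
    if i: "Suc i \<le> n - k" for i
  proof -
    define a b where "a = pattern (win i)" and "b = pattern (win (Suc i))"
    have a: "a \<in> n_permutations k" "order_isomorphic a (win i)"
      using node[of i] i pattern_props(2)[OF dw] by (simp_all add: a_def)
    have b: "b \<in> n_permutations k" "order_isomorphic b (win (Suc i))"
      using node[of "Suc i"] i pattern_props(2)[OF dw] by (simp_all add: b_def)
    have la: "length a = k" and lb: "length b = k"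
      using a(1) b(1) length_n_permutations by blast+
    have "order_isomorphic (take (k - 1) (drop 1 a)) (take (k - 1) (drop 1 (win i)))"
      using a(2) by (rule order_isomorphic_sub)
    moreover have "take (k - 1) (drop 1 a) = tl a" using la by (simp add: drop_Suc)
    moreover have "take (k - 1) (drop 1 (win i)) = butlast (win (Suc i))"
      using lw[OF i] i assms len
      by (intro nth_equalityI) (auto simp: win_def nth_butlast)
    moreover have "order_isomorphic (take (k - 1) (drop 0 b)) (take (k - 1) (drop 0 (win (Suc i))))"
      using b(2) by (rule order_isomorphic_sub)
    moreover have "take (k - 1) (drop 0 b) = butlast b" using lb by (simp add: butlast_conv_take)
    moreover have "take (k - 1) (drop 0 (win (Suc i))) = butlast (win (Suc i))"
      using lw[OF i] by (simp add: butlast_conv_take)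
    ultimately have "order_isomorphic (tl a) (butlast b)"
      by (metis order_isomorphic_sym order_isomorphic_trans)
    moreover have "distinct (tl a)" "distinct (butlast b)"
      using a(1) b(1) by (simp_all add: n_permutations_iff distinct_tl distinct_butlast)
    ultimately have "pattern (tl a) = pattern (butlast b)" by (simp add: pattern_eq_iff)
    then show ?thesis using a(1) b(1) by (simp add: overlap_graph_def a_def b_def)
  qed
  show "vwalk (overlap_path k \<pi>) (overlap_graph k)"
    unfolding vwalk_def
  proof (intro conjI subsetI)
    fix x assume "x \<in> set (overlap_path k \<pi>)"
    then obtain i where "i \<le> n - k" "x = pattern (win i)"
      using nth len' by (metis in_set_conv_nth less_Suc_eq_le Suc_eq_plus1)
    then show "x \<in> verts (overlap_graph k)" using node by (simp add: overlap_graph_def)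
  next
    fix e assume "e \<in> set (vwalk_arcs (overlap_path k \<pi>))"
    then obtain i where i: "Suc i < n - k + 1" "e = (overlap_path k \<pi> ! i, overlap_path k \<pi> ! Suc i)"
      using vwalk_arcs_nth len' by metis
    then show "e \<in> arcs_ends (overlap_graph k)" using arc[of i] nth by simp
  next
    show "overlap_path k \<pi> \<noteq> []" using len' by auto
  qed
qed

end

theory Submission
  imports Defs
begin

text \<open>The path of a permutation records exactly the relative order of the letters at any two
  positions at distance less than \<open>k\<close>. If two consecutive values lie further apart, exchanging
  them leaves the path unchanged; if no two do, the order of consecutive values, and hence of all
  values, can be read off the path. So uniquely determined permutations correspond to the
  sequences that visit every position once by steps of length at most \<open>k - 1\<close>.

  Upper bound: with \<open>m = 2(k - 1)\<close>, every step has at most \<open>m\<close> choices, and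
  at most \<open>m - 1\<close> from the second step on because stepping back is excluded; the loss of one
  choice per step absorbs the factor \<open>n\<close> for the start by Bernoulli's inequality. Lower
  bound: visit blocks of \<open>k\<close> positions one after the other, entering each at its first
  position and continuing arbitrarily, so that the next block is always within reach. Together with
  the reversed sequences, which end rather than start at the first position, this gives the bound up
  to one further sequence, \<open>1, 0, 2, 3, \<dots>\<close>.\<close>

text \<open>Distance below \<open>k\<close>, written additively to avoid truncated subtraction. For
  positive \<open>k\<close> it is reflexive, so walks owe their nonzero steps to
  distinctness.\<close>

definition near :: "nat \<Rightarrow> nat \<Rightarrow> nat \<Rightarrow> bool" where
  "near k i j \<longleftrightarrow> i < j + k \<and> j < i + k"

text \<open>A walk lists the positions, counted from 0, of the values \<open>1, 2, \<dots>, n\<close>.\<close>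

definition position_walks :: "nat \<Rightarrow> nat \<Rightarrow> nat list set" where
  "position_walks k n = {q \<in> permutations_of_set {..<n}. successively (near k) q}"

text \<open>Sorting the indices by their entries gives the inverse permutation in one-line form when
  \<open>q\<close> permutes \<open>{..<n}\<close>.\<close>

definition list_inverse :: "nat list \<Rightarrow> nat list" where
  "list_inverse q = sort_key ((!) q) [0..<length q]"

section \<open>Unique determination and positions of consecutive values\<close>

lemma near_commute: "near k i j \<longleftrightarrow> near k j i"
  by (auto simp: near_def)

text \<open>Two positions lie at distance below \<open>k\<close> exactly when some window of length
  \<open>k\<close> contains both, and the pattern of a window amounts to the comparisons inside
  it.\<close>

lemma overlap_path_eq_iff:
  assumes "\<sigma> \<in> n_permutations n" "\<pi> \<in> n_permutations n" "1 \<le> k" "k \<le> n"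
  shows "overlap_path k \<sigma> = overlap_path k \<pi> \<longleftrightarrow>
    (\<forall>i<n. \<forall>j<n. near k i j \<longrightarrow> (\<sigma> ! i < \<sigma> ! j \<longleftrightarrow> \<pi> ! i < \<pi> ! j))"
proof -
  have len: "length \<sigma> = n" "length \<pi> = n" and d: "distinct \<sigma>" "distinct \<pi>"
    using assms length_n_permutations n_permutations_iff by blast+
  have "overlap_path k \<sigma> = overlap_path k \<pi> \<longleftrightarrow>
    (\<forall>s\<le>n - k. pattern (take k (drop s \<sigma>)) = pattern (take k (drop s \<pi>)))"
    unfolding overlap_path_def len by (auto simp: less_Suc_eq_le simp del: upt_Suc)
  also have "\<dots> \<longleftrightarrow> (\<forall>s\<le>n - k. order_isomorphic (take k (drop s \<sigma>)) (take k (drop s \<pi>)))"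
    using d by (simp add: pattern_eq_iff)
  also have "\<dots> \<longleftrightarrow> (\<forall>s\<le>n - k. \<forall>a<k. \<forall>b<k.
      \<sigma> ! (s + a) < \<sigma> ! (s + b) \<longleftrightarrow> \<pi> ! (s + a) < \<pi> ! (s + b))"
    using assms(4) by (auto simp: order_isomorphic_def len)
  also have "\<dots> \<longleftrightarrow> (\<forall>i<n. \<forall>j<n. near k i j \<longrightarrow> (\<sigma> ! i < \<sigma> ! j \<longleftrightarrow> \<pi> ! i < \<pi> ! j))"
    (is "?L \<longleftrightarrow> ?R")
  proof
    assume L: ?L
    show ?R
    proof (intro allI impI)
      fix i j assume ij: "i < n" "j < n" "near k i j"
      \<comment> \<open>The window should start at the smaller position; the cap
        \<open>n - k\<close> keeps it inside the word, and a window starting there reaches the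
        end.\<close>
      define s where "s = min (n - k) (min i j)"
      have "s \<le> n - k" "i - s < k" "j - s < k" "s \<le> i" "s \<le> j"
        using ij assms(3,4) by (auto simp: s_def near_def min_def)
      then show "\<sigma> ! i < \<sigma> ! j \<longleftrightarrow> \<pi> ! i < \<pi> ! j"
        using L[rule_format, of s "i - s" "j - s"] by simp
    qed
  next
    assume R: ?R
    show ?L
      using R assms(4) by (auto simp: near_def)
  qed
  finally show ?thesis .
qed

text \<open>Swapping the values \<open>v\<close> and \<open>v + 1\<close> changes only the
  comparison between their two positions, and no window sees both.\<close>

lemma not_uniquely_determined:
  assumes \<pi>: "\<pi> \<in> n_permutations n" and k: "1 \<le> k" "k \<le> n"
    and ij: "i < n" "j < n" "\<pi> ! j = Suc (\<pi> ! i)" "\<not> near k i j"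
  shows "\<not> uniquely_determined k n \<pi>"
proof -
  have len: "length \<pi> = n" and d: "distinct \<pi>" and s: "set \<pi> = {1..n}"
    using \<pi> length_n_permutations n_permutations_iff by blast+
  define t where "t = Transposition.transpose (\<pi> ! i) (\<pi> ! j)"
  define \<sigma> where "\<sigma> = map t \<pi>"
  have mem: "\<pi> ! i \<in> {1..n}" "\<pi> ! j \<in> {1..n}" using ij len s nth_mem by metis+
  have "t ` {1..n} = {1..n}" unfolding t_def using mem by (simp add: transpose_image_eq)
  moreover have "inj t" unfolding t_def by (simp add: inj_transpose)
  ultimately have \<sigma>: "\<sigma> \<in> n_permutations n"
    using d s by (auto simp: n_permutations_iff \<sigma>_def distinct_map inj_on_def)
  have "\<sigma> ! i \<noteq> \<pi> ! i" using ij len by (simp add: \<sigma>_def t_def)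
  then have ne: "\<sigma> \<noteq> \<pi>" by auto
  have "\<sigma> ! a < \<sigma> ! b \<longleftrightarrow> \<pi> ! a < \<pi> ! b" if ab: "a < n" "b < n" "near k a b" for a b
  proof -
    have "\<not> (\<pi> ! a = \<pi> ! i \<and> \<pi> ! b = \<pi> ! j)" "\<not> (\<pi> ! a = \<pi> ! j \<and> \<pi> ! b = \<pi> ! i)"
      using ab ij d len near_commute by (metis nth_eq_iff_index_eq)+
    then show ?thesis
      using ab ij(3) len by (auto simp: \<sigma>_def t_def Transposition.transpose_def)
  qed
  then have "overlap_path k \<sigma> = overlap_path k \<pi>"
    using overlap_path_eq_iff[OF \<sigma> \<pi> k] by blast
  then show ?thesis using \<sigma> ne by (auto simp: uniquely_determined_def)
qed

lemma uniquely_determined_iff: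
  assumes \<pi>: "\<pi> \<in> n_permutations n" and k: "1 \<le> k" "k \<le> n"
  shows "uniquely_determined k n \<pi> \<longleftrightarrow>
    (\<forall>i<n. \<forall>j<n. \<pi> ! j = Suc (\<pi> ! i) \<longrightarrow> near k i j)"
proof
  assume "uniquely_determined k n \<pi>"
  then show "\<forall>i<n. \<forall>j<n. \<pi> ! j = Suc (\<pi> ! i) \<longrightarrow> near k i j"
    using not_uniquely_determined[OF \<pi> k] by blast
next
  assume adj: "\<forall>i<n. \<forall>j<n. \<pi> ! j = Suc (\<pi> ! i) \<longrightarrow> near k i j"
  have len: "length \<pi> = n" and d: "distinct \<pi>" and s: "set \<pi> = {1..n}"
    using \<pi> length_n_permutations n_permutations_iff by blast+
  have "\<sigma> = \<pi>" if \<sigma>: "\<sigma> \<in> n_permutations n" and eq: "overlap_path k \<sigma> = overlap_path k \<pi>" for \<sigma>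
  proof -
    have len\<sigma>: "length \<sigma> = n" using \<sigma> length_n_permutations by blast
    have local: "\<sigma> ! i < \<sigma> ! j \<longleftrightarrow> \<pi> ! i < \<pi> ! j" if "i < n" "j < n" "near k i j" for i j
      using overlap_path_eq_iff[OF \<sigma> \<pi> k] eq that by blast
    \<comment> \<open>Induction on the gap between the two values: the position \<open>l\<close> of
      the value just above that at \<open>i\<close> is near \<open>i\<close>, so the path fixes the
      first comparison of the chain.\<close>
    have up: "\<sigma> ! i < \<sigma> ! j" if "i < n" "j < n" "\<pi> ! j = Suc (\<pi> ! i + m)" for i j m
      using that
    proof (induction m arbitrary: i)
      case 0
      then show ?case using adj local by simp
    next
      case (Suc m)
      have "\<pi> ! j \<le> n" using Suc.prems s len nth_mem by (metis atLeastAtMost_iff)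
      then have "Suc (\<pi> ! i) \<in> set \<pi>" using Suc.prems s by simp
      then obtain l where l: "l < n" "\<pi> ! l = Suc (\<pi> ! i)" using len by (metis in_set_conv_nth)
      have "\<sigma> ! i < \<sigma> ! l" using l Suc.prems adj local by simp
      also have "\<dots> < \<sigma> ! j" using Suc l by simp
      finally show ?case .
    qed
    have up': "\<sigma> ! i < \<sigma> ! j" if "i < n" "j < n" "\<pi> ! i < \<pi> ! j" for i j
      using up[OF that(1,2)] less_imp_Suc_add[OF that(3)] by blast
    have "order_isomorphic \<sigma> \<pi>"
      unfolding order_isomorphic_def len len\<sigma>
    proof (intro conjI allI impI refl)
      fix i j assume "i < n" "j < n"
      then show "\<sigma> ! i < \<sigma> ! j \<longleftrightarrow> \<pi> ! i < \<pi> ! j"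
        using up' d len by (metis linorder_less_linear not_less_iff_gr_or_eq nth_eq_iff_index_eq)
    qed
    then show ?thesis using order_isomorphic_n_permutations_eq \<sigma> \<pi> by blast
  qed
  then show "uniquely_determined k n \<pi>" using \<pi> by (auto simp: uniquely_determined_def)
qed

section \<open>Inverse permutations and the bijection with position walks\<close>

lemma list_inverse_props:
  assumes "q \<in> permutations_of_set {..<n}"
  shows "list_inverse q \<in> permutations_of_set {..<n}"
    and "j < n \<Longrightarrow> q ! (list_inverse q ! j) = j"
proof -
  have d: "distinct q" "set q = {..<n}" using assms by (auto simp: permutations_of_set_def)
  then have len: "length q = n" using distinct_card by fastforce
  show *: "list_inverse q \<in> permutations_of_set {..<n}"
    by (auto simp: list_inverse_def permutations_of_set_def len)
  \<comment> \<open>The entries of \<open>q\<close> read along \<open>list_inverse q\<close> are a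
    sorted rearrangement of \<open>[0..<n]\<close>, hence equal to it.\<close>
  have "sorted (map ((!) q) (list_inverse q))" by (simp add: list_inverse_def)
  moreover have "mset (map ((!) q) (list_inverse q)) = mset [0..<n]"
  proof -
    have "mset (map ((!) q) (list_inverse q)) = mset (map ((!) q) [0..<length q])"
      by (simp add: list_inverse_def)
    also have "\<dots> = mset q" by (simp only: map_nth)
    also have "\<dots> = mset [0..<n]" using d by (metis atLeast_upt distinct_upt set_eq_iff_mset_eq_distinct)
    finally show ?thesis .
  qed
  ultimately have "map ((!) q) (list_inverse q) = [0..<n]"
    by (metis properties_for_sort sorted_sort_id sorted_upt)
  moreover have "length (list_inverse q) = n" by (simp add: list_inverse_def len)
  ultimately show "j < n \<Longrightarrow> q ! (list_inverse q ! j) = j"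
    by (metis add_0 nth_map nth_upt)
qed

lemma length_permutations_lessThan: "q \<in> permutations_of_set {..<n} \<Longrightarrow> length q = n"
  by (auto dest: length_finite_permutations_of_set)

lemma list_inverse_involution:
  assumes "q \<in> permutations_of_set {..<n}"
  shows "list_inverse (list_inverse q) = q"
proof (rule nth_equalityI)
  note p = list_inverse_props[OF assms]
  note r = list_inverse_props[OF p(1)]
  have len: "length (list_inverse (list_inverse q)) = n" "length q = n"
    using length_permutations_lessThan r(1) assms by blast+
  then show "length (list_inverse (list_inverse q)) = length q" by simp
  fix j assume "j < length (list_inverse (list_inverse q))"
  then have j: "j < n" by (simp add: len)
  have "list_inverse (list_inverse q) ! j < n"
    using j len r(1) by (metis permutations_of_setD(1) nth_mem lessThan_iff)
  then show "list_inverse (list_inverse q) ! j = q ! j" using p(2) r(2)[OF j] by metis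
qed

text \<open>Removing \<open>Suc\<close> from the letters leaves a permutation \<open>p\<close> of
  \<open>{..<n}\<close>. Its inverse lists the positions of successive values, so the criterion on
  consecutive values becomes a condition on the steps of the inverse.\<close>

lemma num_uniquely_determined_eq:
  assumes k: "1 \<le> k" "k \<le> n"
  shows "num_uniquely_determined k n = card (position_walks k n)"
proof -
  have walk_iff: "uniquely_determined k n (map Suc p) \<longleftrightarrow> list_inverse p \<in> position_walks k n"
    if p: "p \<in> permutations_of_set {..<n}" for p
  proof -
    let ?q = "list_inverse p"
    have len: "length p = n" "length ?q = n"
      using length_permutations_lessThan list_inverse_props(1) p by blast+
    have rng: "\<And>j. j < n \<Longrightarrow> p ! j < n" "\<And>j. j < n \<Longrightarrow> ?q ! j < n"
      using len p list_inverse_props(1)[OF p] by (metis permutations_of_setD(1) nth_mem lessThan_iff)+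
    have pq: "p ! (?q ! j) = j" if "j < n" for j using list_inverse_props(2)[OF p that] .
    have qp: "?q ! (p ! j) = j" if "j < n" for j
      using list_inverse_props(2)[OF list_inverse_props(1)[OF p] that]
      by (simp add: list_inverse_involution[OF p])
    have "map Suc p \<in> n_permutations n"
      using p by (auto simp: n_permutations_iff permutations_of_set_def distinct_map image_Suc_lessThan)
    then have "uniquely_determined k n (map Suc p) \<longleftrightarrow>
      (\<forall>i<n. \<forall>j<n. p ! j = Suc (p ! i) \<longrightarrow> near k i j)"
      using uniquely_determined_iff k len by simp
    \<comment> \<open>Substitute \<open>v = p ! i\<close>, so that \<open>i = ?q ! v\<close> and
      \<open>j = ?q ! Suc v\<close>.\<close>
    also have "\<dots> \<longleftrightarrow> (\<forall>v. Suc v < n \<longrightarrow> near k (?q ! v) (?q ! Suc v))"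
      using rng pq qp by (metis Suc_lessD)
    also have "\<dots> \<longleftrightarrow> ?q \<in> position_walks k n"
      using list_inverse_props(1)[OF p] by (auto simp: position_walks_def successively_conv_nth len)
    finally show ?thesis .
  qed
  have "bij_betw (\<lambda>q. map Suc (list_inverse q)) (position_walks k n) {\<pi>. uniquely_determined k n \<pi>}"
    unfolding bij_betw_def
  proof
    show "inj_on (\<lambda>q. map Suc (list_inverse q)) (position_walks k n)"
      by (rule inj_on_inverseI[where g = "\<lambda>\<pi>. list_inverse (map (\<lambda>x. x - 1) \<pi>)"])
        (auto simp: position_walks_def list_inverse_involution comp_def)
    show "(\<lambda>q. map Suc (list_inverse q)) ` position_walks k n = {\<pi>. uniquely_determined k n \<pi>}"
    proof (intro equalityI subsetI)
      fix \<pi> assume "\<pi> \<in> (\<lambda>q. map Suc (list_inverse q)) ` position_walks k n"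
      then obtain q where q: "q \<in> position_walks k n" "\<pi> = map Suc (list_inverse q)" by auto
      then have "q \<in> permutations_of_set {..<n}" by (simp add: position_walks_def)
      then show "\<pi> \<in> {\<pi>. uniquely_determined k n \<pi>}"
        using q walk_iff list_inverse_props(1) list_inverse_involution by simp
    next
      fix \<pi> assume "\<pi> \<in> {\<pi>. uniquely_determined k n \<pi>}"
      then have u: "uniquely_determined k n \<pi>" by simp
      then have \<pi>: "distinct \<pi>" "set \<pi> = {1..n}"
        by (auto simp: uniquely_determined_def n_permutations_iff)
      define p where "p = map (\<lambda>x. x - 1) \<pi>"
      have \<pi>p: "\<pi> = map Suc p" using \<pi>(2) by (auto simp: p_def intro!: map_idI[symmetric])
      have "Suc ` set p = Suc ` {..<n}" using \<pi>(2) by (simp add: \<pi>p image_Suc_lessThan)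
      then have "set p = {..<n}" by (simp add: inj_image_eq_iff)
      then have p: "p \<in> permutations_of_set {..<n}"
        using \<pi>(1) by (simp add: \<pi>p distinct_map permutations_of_set_def)
      then show "\<pi> \<in> (\<lambda>q. map Suc (list_inverse q)) ` position_walks k n"
        using u walk_iff[OF p] \<pi>p list_inverse_involution[OF p]
        by (intro image_eqI[where x = "list_inverse p"]) auto
    qed
  qed
  then show ?thesis unfolding num_uniquely_determined_def by (simp add: bij_betw_same_card)
qed

section \<open>Upper bound by counting self-avoiding walks\<close>

text \<open>The length \<open>l\<close> is kept apart from the number \<open>N\<close> of positions
  so that walks can be counted by induction on length with the positions fixed.\<close>

definition self_avoiding_walks :: "nat \<Rightarrow> nat \<Rightarrow> nat \<Rightarrow> nat list set" where
  "self_avoiding_walks k N l =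
     {q. length q = l \<and> distinct q \<and> set q \<subseteq> {..<N} \<and> successively (near k) q}"

lemma finite_self_avoiding_walks [simp]: "finite (self_avoiding_walks k N l)"
  by (rule finite_subset[OF _ finite_lists_length_eq[of "{..<N}" l]])
    (auto simp: self_avoiding_walks_def)

lemma near_set: "{z. near k z x} \<subseteq> {x + 1 - k..x + k - 1}"
  by (auto simp: near_def)

lemma finite_near [simp]: "finite {z. near k z x}"
  by (rule finite_subset[OF near_set]) simp

lemma card_near_le: "1 \<le> k \<Longrightarrow> card {z. near k z x} \<le> 2 * (k - 1) + 1"
proof -
  assume "1 \<le> k"
  have "card {z. near k z x} \<le> card {x + 1 - k..x + k - 1}"
    by (intro card_mono near_set) auto
  also have "\<dots> \<le> 2 * (k - 1) + 1" using \<open>1 \<le> k\<close> by auto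
  finally show ?thesis .
qed

text \<open>The tail of a walk is again a walk. Walks grow at the head, where the list structure
  exposes the current endpoint and the position before it.\<close>

lemma card_self_avoiding_walks_step:
  assumes "\<And>q. q \<in> self_avoiding_walks k N l \<Longrightarrow>
    card {z. z # q \<in> self_avoiding_walks k N (Suc l)} \<le> c"
  shows "card (self_avoiding_walks k N (Suc l)) \<le> c * card (self_avoiding_walks k N l)"
proof -
  let ?S = "self_avoiding_walks k N"
  let ?E = "\<lambda>q. {z. z # q \<in> ?S (Suc l)}"
  have "?S (Suc l) \<subseteq> (\<Union>q\<in>?S l. (\<lambda>z. z # q) ` ?E q)"
  proof
    fix p assume p: "p \<in> ?S (Suc l)"
    then obtain z q where zq: "p = z # q" by (auto simp: self_avoiding_walks_def length_Suc_conv)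
    then have "q \<in> ?S l" using p by (auto simp: self_avoiding_walks_def successively_Cons)
    then show "p \<in> (\<Union>q\<in>?S l. (\<lambda>z. z # q) ` ?E q)" using p zq by auto
  qed
  moreover have fin: "finite (?E q)" for q
    by (rule finite_subset[of _ "{..<N}"]) (auto simp: self_avoiding_walks_def)
  ultimately have "card (?S (Suc l)) \<le> card (\<Union>q\<in>?S l. (\<lambda>z. z # q) ` ?E q)"
    by (intro card_mono) auto
  also have "\<dots> \<le> (\<Sum>q\<in>?S l. card ((\<lambda>z. z # q) ` ?E q))" by (intro card_UN_le) simp
  also have "\<dots> \<le> (\<Sum>q\<in>?S l. c)"
    by (intro sum_mono order_trans[OF card_image_le[OF fin]] assms)
  finally show ?thesis by (simp add: mult.commute)
qed

lemma card_self_avoiding_walks_le: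
  assumes k: "2 \<le> k"
  shows "card (self_avoiding_walks k N (Suc (Suc l)))
    \<le> N * (2 * (k - 1)) * (2 * (k - 1) - 1) ^ l"
proof (induction l)
  case 0
  have "card (self_avoiding_walks k N 0) \<le> 1"
    by (simp add: self_avoiding_walks_def card_le_Suc0_iff_eq)
  moreover have "card (self_avoiding_walks k N (Suc 0)) \<le> N * card (self_avoiding_walks k N 0)"
  proof (rule card_self_avoiding_walks_step)
    fix q
    have "card {z. z # q \<in> self_avoiding_walks k N (Suc 0)} \<le> card {..<N}"
      by (intro card_mono) (auto simp: self_avoiding_walks_def)
    then show "card {z. z # q \<in> self_avoiding_walks k N (Suc 0)} \<le> N" by simp
  qed
  ultimately have one: "card (self_avoiding_walks k N (Suc 0)) \<le> N"
    by (metis dual_order.trans mult.right_neutral mult_le_mono2)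
  have "card (self_avoiding_walks k N (Suc (Suc 0)))
      \<le> 2 * (k - 1) * card (self_avoiding_walks k N (Suc 0))"
  proof (rule card_self_avoiding_walks_step)
    fix q assume "q \<in> self_avoiding_walks k N (Suc 0)"
    then obtain x where q: "q = [x]" by (auto simp: self_avoiding_walks_def length_Suc_conv)
    \<comment> \<open>Distinctness excludes \<open>x\<close>, which is counted among the positions
      near itself.\<close>
    have "card {z. z # q \<in> self_avoiding_walks k N (Suc (Suc 0))} \<le> card ({z. near k z x} - {x})"
      by (intro card_mono) (auto simp: self_avoiding_walks_def q)
    also have "\<dots> = card {z. near k z x} - 1"
      using k by (subst card_Diff_subset) (auto simp: near_def)
    also have "\<dots> \<le> 2 * (k - 1)" using card_near_le[of k x] k by simp
    finally show "card {z. z # q \<in> self_avoiding_walks k N (Suc (Suc 0))} \<le> 2 * (k - 1)" .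
  qed
  also have "\<dots> \<le> 2 * (k - 1) * N" using one by (rule mult_le_mono2)
  finally show ?case by (simp add: mult.commute)
next
  case (Suc l)
  have "card (self_avoiding_walks k N (Suc (Suc (Suc l))))
      \<le> (2 * (k - 1) - 1) * card (self_avoiding_walks k N (Suc (Suc l)))"
  proof (rule card_self_avoiding_walks_step)
    fix q assume "q \<in> self_avoiding_walks k N (Suc (Suc l))"
    then obtain x y r where q: "q = x # y # r" and xy: "near k x y" "x \<noteq> y"
      by (auto simp: self_avoiding_walks_def length_Suc_conv)
    \<comment> \<open>Stepping back to \<open>y\<close> is excluded as well, and \<open>y\<close> is
      near \<open>x\<close>, so a second choice is lost.\<close>
    have "card {z. z # q \<in> self_avoiding_walks k N (Suc (Suc (Suc l)))}
        \<le> card ({z. near k z x} - {x, y})"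
      by (intro card_mono) (auto simp: self_avoiding_walks_def q)
    also have "\<dots> = card {z. near k z x} - 2"
      using k xy by (subst card_Diff_subset) (auto simp: near_def)
    also have "\<dots> \<le> 2 * (k - 1) - 1" using card_near_le[of k x] k by simp
    finally show "card {z. z # q \<in> self_avoiding_walks k N (Suc (Suc (Suc l)))}
      \<le> 2 * (k - 1) - 1" .
  qed
  also have "\<dots> \<le> (2 * (k - 1) - 1) * (N * (2 * (k - 1)) * (2 * (k - 1) - 1) ^ l)"
    by (intro mult_le_mono2 Suc.IH)
  finally show ?case by (simp add: ac_simps)
qed

text \<open>Bernoulli's inequality for \<open>1 + 1/c\<close>, multiplied by
  \<open>c ^ Suc l\<close>, is the first displayed bound; adding \<open>c ^ l\<close> and using
  \<open>1 \<le> c\<close> gives the claim.\<close>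

lemma linear_times_power_le:
  fixes c l :: nat
  assumes "1 \<le> c"
  shows "(l + 2) * c ^ l \<le> (c + 1) ^ Suc l"
proof -
  have "(l + c) * c ^ l \<le> c * (c + 1) ^ l"
  proof (induction l)
    case (Suc l)
    have "c ^ l \<le> (c + 1) ^ l" by (intro power_mono) auto
    have "(Suc l + c) * c ^ Suc l = c * ((l + c) * c ^ l) + c * c ^ l"
      by (simp add: algebra_simps)
    also have "\<dots> \<le> c * (c * (c + 1) ^ l) + c * (c + 1) ^ l"
      using Suc \<open>c ^ l \<le> (c + 1) ^ l\<close> by (intro add_mono mult_le_mono2)
    also have "\<dots> = c * (c + 1) ^ Suc l" by (simp add: algebra_simps)
    finally show ?case .
  qed simp
  moreover have "c ^ l \<le> (c + 1) ^ l" by (intro power_mono) auto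
  moreover have "(l + 2) * c ^ l \<le> (l + c) * c ^ l + c ^ l"
    using assms by (simp add: algebra_simps)
  ultimately have "(l + 2) * c ^ l \<le> c * (c + 1) ^ l + (c + 1) ^ l" by linarith
  then show ?thesis by (simp add: algebra_simps)
qed

lemma card_position_walks_less:
  assumes k: "2 \<le> k" and n: "2 \<le> n"
  shows "card (position_walks k n) < 2 * (2 * (k - 1)) ^ n"
proof -
  define c where "c = 2 * (k - 1) - 1"
  have c: "1 \<le> c" "2 * (k - 1) = c + 1" using k by (auto simp: c_def)
  obtain l where l: "n = Suc (Suc l)" using n by (metis numeral_2_eq_2 le_Suc_ex add_Suc)
  have "position_walks k n \<subseteq> self_avoiding_walks k n n"
    using length_permutations_lessThan
    by (auto simp: position_walks_def self_avoiding_walks_def permutations_of_setD)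
  then have "card (position_walks k n) \<le> card (self_avoiding_walks k n n)"
    by (intro card_mono) auto
  also have "\<dots> \<le> n * (2 * (k - 1)) * (2 * (k - 1) - 1) ^ l"
    using card_self_avoiding_walks_le[OF k, of n l] by (simp only: l)
  \<comment> \<open>The number \<open>n = l + 2\<close> of starting positions is grouped with
    \<open>c ^ l\<close>, to be absorbed by the preceding inequality.\<close>
  also have "\<dots> = (c + 1) * ((l + 2) * c ^ l)" using c by (simp add: l algebra_simps)
  also have "\<dots> \<le> (c + 1) * (c + 1) ^ Suc l"
    by (intro mult_le_mono2 linear_times_power_le c)
  also have "\<dots> = (c + 1) ^ n" by (simp add: l)
  also have "\<dots> < 2 * (c + 1) ^ n" by simp
  finally show ?thesis using c by simp
qed

section \<open>Lower bound by walks through blocks\<close>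

definition block_walks :: "nat \<Rightarrow> nat \<Rightarrow> nat list set" where
  "block_walks k n = {q \<in> position_walks k n. q \<noteq> [] \<longrightarrow> hd q = 0}"

lemma finite_position_walks [simp]: "finite (position_walks k n)"
  by (simp add: position_walks_def)

lemma finite_block_walks [simp]: "finite (block_walks k n)"
  by (simp add: block_walks_def)

text \<open>Positions inside one block are pairwise near. Since \<open>s\<close> is nonempty, the
  block is left from a position at least 1, and the next one is entered at \<open>k\<close>, so the
  crossing has length at most \<open>k - 1\<close>.\<close>

lemma block_walks_append:
  assumes k: "2 \<le> k" "k \<le> n" and s: "s \<in> permutations_of_set {1..<k}"
    and q: "q \<in> block_walks k (n - k)"
  shows "0 # s @ map (\<lambda>x. x + k) q \<in> block_walks k n"
proof -
  have s': "set s = {1..<k}" "distinct s" using s by (auto simp: permutations_of_set_def)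
  have q': "set q = {..<n - k}" "distinct q" "successively (near k) q" "q \<noteq> [] \<Longrightarrow> hd q = 0"
    using q by (auto simp: block_walks_def position_walks_def permutations_of_set_def)
  have "(\<lambda>x. x + k) ` {..<n - k} = {k..<n}"
    using k image_add_atLeastLessThan'[of k 0 "n - k"] by (simp add: lessThan_atLeast0)
  then have "set (0 # s @ map (\<lambda>x. x + k) q) = insert 0 ({1..<k} \<union> {k..<n})"
    using s'(1) q'(1) by simp
  also have "\<dots> = {..<n}" using k by auto
  finally have st: "set (0 # s @ map (\<lambda>x. x + k) q) = {..<n}" .
  have ds: "distinct (0 # s @ map (\<lambda>x. x + k) q)"
    using s' q'(2) k by (auto simp: distinct_map)
  have "s \<noteq> []" using s'(1) k by auto
  then have "last s \<in> {1..<k}" using s'(1) last_in_set by blast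
  moreover have "successively (near k) (0 # s)"
  proof (rule successively_mono[of "\<lambda>_ _. True"])
    show "successively (\<lambda>_ _. True) (0 # s)" by (simp add: successively_conv_nth)
  next
    show "near k x y" if "x \<in> set (0 # s)" "y \<in> set (0 # s)" for x y
      using that s'(1) k by (auto simp: near_def)
  qed
  moreover have "successively (near k) (map (\<lambda>x. x + k) q)"
    using q'(3) by (simp add: successively_map near_def)
  ultimately have "successively (near k) ((0 # s) @ map (\<lambda>x. x + k) q)"
    using q'(4) \<open>s \<noteq> []\<close> unfolding successively_append_iff
    by (cases q) (auto simp: near_def)
  then show ?thesis
    using st ds by (simp add: block_walks_def position_walks_def permutations_of_set_def)
qed

lemma card_block_walks_ge:
  assumes k: "2 \<le> k"
  shows "fact (k - 1) ^ (n div k) \<le> card (block_walks k n)"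
proof (induction n rule: less_induct)
  case (less n)
  show ?case
  proof (cases "n < k")
    case True
    \<comment> \<open>With no full block left the bound is 1, and the increasing walk attains
      it.\<close>
    have "successively (near k) [0..<n]" using k by (auto simp: successively_conv_nth near_def)
    then have "[0..<n] \<in> block_walks k n"
      by (auto simp: block_walks_def position_walks_def permutations_of_set_def)
    then have "0 < card (block_walks k n)" by (auto simp: card_gt_0_iff)
    then show ?thesis using True by simp
  next
    case False
    let ?P = "permutations_of_set {1..<k} \<times> block_walks k (n - k)"
    let ?f = "\<lambda>(s, q). 0 # s @ map (\<lambda>x. x + k) q"
    have "inj_on ?f ?P"
    proof (rule inj_onI)
      fix u v assume uv: "u \<in> ?P" "v \<in> ?P" "?f u = ?f v"
      obtain s q s' q' where sq: "u = (s, q)" "v = (s', q')" by (cases u, cases v) blast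
      \<comment> \<open>Equal lengths fix where the appended lists split, so both components can be
        recovered.\<close>
      with uv have "length s = length s'" by (auto dest!: length_finite_permutations_of_set)
      with uv(3) sq show "u = v" by (auto simp: inj_map_eq_map inj_def)
    qed
    moreover have "?f ` ?P \<subseteq> block_walks k n" using block_walks_append k False by auto
    ultimately have card_le: "card ?P \<le> card (block_walks k n)" by (intro card_inj_on_le) auto
    have "n div k = Suc ((n - k) div k)" using False k by (simp add: le_div_geq)
    then have "fact (k - 1) ^ (n div k) = fact (k - 1) * fact (k - 1) ^ ((n - k) div k)" by simp
    also have "\<dots> \<le> fact (k - 1) * card (block_walks k (n - k))"
      using less False k by (intro mult_le_mono2) simp
    also have "\<dots> = card ?P" by (simp add: card_cartesian_product)
    finally show ?thesis using card_le by linarith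
  qed
qed

text \<open>Walks starting at 0 end elsewhere, so they and their reversals form disjoint families of
  equal size. The extra walk neither starts nor ends at 0, which makes the inequality
  strict.\<close>

lemma card_position_walks_greater:
  assumes k: "3 \<le> k" "k \<le> n"
  shows "2 * fact (k - 1) ^ (n div k) < card (position_walks k n)"
proof -
  let ?B = "block_walks k n" and ?x = "1 # 0 # [2..<n]"
  have rev_walk: "rev q \<in> position_walks k n" if "q \<in> position_walks k n" for q
    using that by (auto simp: position_walks_def permutations_of_set_def near_commute)
  have B: "q \<noteq> [] \<and> hd q = 0 \<and> last q \<noteq> 0" if "q \<in> ?B" for q
  proof -
    have "length q = n" "distinct q"
      using that length_permutations_lessThan
      by (auto simp: block_walks_def position_walks_def permutations_of_set_def)
    then obtain a b r where q: "q = a # b # r" using k by (cases q; cases "tl q") auto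
    then have "a = 0" using that by (simp add: block_walks_def)
    moreover have "last q \<in> set (b # r)" using q by simp
    ultimately show ?thesis using \<open>distinct q\<close> q by (metis distinct.simps(2) list.discI list.sel(1))
  qed
  have "successively (near k) [2..<n]" using k by (auto simp: successively_conv_nth near_def)
  \<comment> \<open>The step from 0 to 2 needs \<open>3 \<le> k\<close>.\<close>
  then have "successively (near k) ?x" using k by (auto simp: successively_Cons near_def)
  then have x: "?x \<in> position_walks k n"
    using k by (auto simp: position_walks_def permutations_of_set_def)
  have sub: "insert ?x (?B \<union> rev ` ?B) \<subseteq> position_walks k n"
    using x rev_walk by (auto simp: block_walks_def)
  have "rev q \<notin> ?B" if "q \<in> ?B" for q
    using B[OF that] B[of "rev q"] by (auto simp: hd_rev)
  then have disj: "?B \<inter> rev ` ?B = {}" by auto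
  have new: "?x \<notin> ?B \<union> rev ` ?B" 
  proof -
    have "last ?x \<noteq> 0" using k by simp
    then have "?x \<noteq> rev q" if "q \<in> ?B" for q using B[OF that] by (metis last_rev)
    moreover have "?x \<notin> ?B" using B[of ?x] by auto
    ultimately show ?thesis by blast
  qed
  have "2 * fact (k - 1) ^ (n div k) < Suc (2 * card ?B)"
    using card_block_walks_ge[of k n] k by simp
  also have "\<dots> = card (insert ?x (?B \<union> rev ` ?B))"
    using disj new by (simp add: card_Un_disjoint card_image)
  also have "\<dots> \<le> card (position_walks k n)" by (intro card_mono sub) simp
  finally show ?thesis .
qed

text \<open>For \<open>k = 2\<close> only the two monotone walks exist, so the lower bound is an
  equality and strictness fails; for \<open>k = 1\<close> the upper bound would be 0.\<close>

theorem theorem4: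
  fixes k n :: nat
  assumes "2 \<le> k" and "k \<le> n"
  shows "(3 \<le> k \<longrightarrow> 2 * fact (k - 1) ^ (n div k) < num_uniquely_determined k n) \<and>
         num_uniquely_determined k n < 2 * (2 * (k - 1)) ^ n"
  using assms num_uniquely_determined_eq[of k n] card_position_walks_greater[of k n]
    card_position_walks_less[of k n] by simp

end
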